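(* Let $N, M \in \mathrm{GL}(3,\mathbb{Z})$ satisfy: (i) $NM = MN$; (ii) $1$ is an eigenvalue of $N^n M^m$ for all $(n,m) \in \mathbb{Z}^2$; (iii) $\{k \in \mathbb{Z}^3 : N^n M^m k = k \text{ for all } (n,m) \in \mathbb{Z}^2\} = \{0\}$. Let $C \in \mathrm{GL}(3,\mathbb{Z})$ commute with both $N$ and $M$, and suppose $1$ is an eigenvalue of $N^n M^m C^s$ for all $(n,m,s) \in \mathbb{Z}^3$. Then $C$ belongs to the subgroup of $\mathrm{GL}(3,\mathbb{Z})$ generated by $N$ and $M$. *)

theory Defs
  imports "HOL-Analysis.Analysis"
begin

type_synonym imat3 = "int^3^3"

text \<open>GL(3,Z): integer 3x3 matrices invertible over the integers.\<close>
definition GL3Z :: "imat3 set" where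
  "GL3Z = {A. invertible A}"

text \<open>Integer powers of a matrix (negative powers use the integer inverse).\<close>
definition mpow :: "imat3 \<Rightarrow> int \<Rightarrow> imat3" where
  "mpow A n = (if 0 \<le> n then (((**) A) ^^ nat n) (mat 1)
               else (((**) (matrix_inv A)) ^^ nat (- n)) (mat 1))"

text \<open>1 is an eigenvalue of the integer matrix A (viewed over the complex numbers).\<close>
definition eig1 :: "imat3 \<Rightarrow> bool" where
  "eig1 A \<longleftrightarrow> (\<exists>v :: complex^3. v \<noteq> 0 \<and> (\<chi> i j. of_int (A $ i $ j)) *v v = v)"

text \<open>Subgroup of GL(3,Z) generated by a set S of elements of GL(3,Z).\<close>
inductive_set gen_subgroup :: "imat3 set \<Rightarrow> imat3 set" for S where
  gen_one: "mat 1 \<in> gen_subgroup S"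
| gen_base: "x \<in> S \<Longrightarrow> x \<in> gen_subgroup S"
| gen_mult: "a \<in> gen_subgroup S \<Longrightarrow> b \<in> gen_subgroup S \<Longrightarrow> a ** b \<in> gen_subgroup S"
| gen_inv: "a \<in> gen_subgroup S \<Longrightarrow> matrix_inv a \<in> gen_subgroup S"

end

theory Submission
  imports Defs "HOL-Computational_Algebra.Fundamental_Theorem_Algebra" "HOL-Library.Product_Plus"
begin

text \<open>Over the complex numbers the commuting matrices N, M, C can be brought simultaneously to
upper triangular form. The diagonal entries then give three characters \<chi>1, \<chi>2, \<chi>3 of
Z^3, evaluated on (n, m, s) as on N^n M^m C^s, and the eigenvalue hypothesis says that Z^3 is the
union of their kernels. None of them is trivial on H = Z^2 x 0, for otherwise N and M would have a
common fixed vector over the complex numbers and hence over the integers. As a group is never the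
union of two proper subgroups, there is an h in H at which every \<chi>i takes its value at
(0, 0, 1), and the \<chi>i are pairwise distinct on H. The triangular forms of C and of
N^n M^m for h = (n, m, 0) thus have the same diagonal, and both commute with triangular matrices
from H whose diagonal entries separate the three positions; this forces them to be equal.\<close>

section \<open>Matrix preliminaries\<close>

lemma invertible_matrix_inv:
  assumes "invertible A"
  shows "A ** matrix_inv A = mat 1" and "matrix_inv A ** A = mat 1"
  using someI_ex[OF assms[unfolded invertible_def]] by (simp_all add: matrix_inv_def)

lemma mat_matrix_vector_mult [simp]: "mat c *v x = c *s x"
  by (simp add: vec_eq_iff matrix_vector_mult_def mat_def if_distrib if_distribR
      cong del: if_weak_cong)

lemma scalar_product_vector_matrix_mult:
  "scalar_product (x v* A) y = scalar_product x (A *v (y :: 'a::comm_semiring_1^'n))"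
  unfolding scalar_product_def vector_matrix_mult_def matrix_vector_mult_def
  by (simp add: sum_distrib_left sum_distrib_right mult_ac) (rule sum.swap)

lemma scalar_product_row_minus_axis:
  fixes A :: "'a::comm_ring_1^'n^'n"
  shows "scalar_product (row i A - axis i 1) x = (A *v x)$i - x$i"
proof -
  have "scalar_product (axis i 1) x = x$i"
    unfolding scalar_product_def axis_def by (simp flip: of_bool_def)
  moreover have "scalar_product (row i A) x = (A *v x)$i"
    by (simp add: scalar_product_def row_def matrix_vector_mult_def)
  ultimately show ?thesis
    by (simp add: scalar_product_def left_diff_distrib sum_subtractf)
qed

lemma scalar_product_cnj_self:
  "scalar_product v (\<chi> i. cnj (v$i)) = complex_of_real (norm v ^ 2)"
  unfolding scalar_product_def norm_vec_def L2_set_def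
  by (simp add: sum_nonneg complex_norm_square[symmetric] del: of_real_power)

lemma det_eq_0_if_kernel:
  fixes A :: "'a::field^'n^'n"
  assumes "A *v x = 0" and "x \<noteq> 0"
  shows "det A = 0"
  by (metis assms invertible_det_nz inj_matrix_vector_mult injD matrix_vector_mult_0_right)

lemma matrix_mult_diff_distrib:
  fixes A B C :: "'a::ring_1^'n^'n"
  shows "A ** (B - C) = A ** B - A ** C" and "(B - C) ** A = B ** A - C ** A"
  by (simp_all add: matrix_matrix_mult_def vec_eq_iff sum_subtractf algebra_simps)

lemma commute_diff_mat:
  fixes A B :: "'a::field^'n^'n"
  assumes "A ** B = B ** A"
  shows "A ** (B - mat c) = (B - mat c) ** A"
proof -
  have "A ** mat c = mat c ** A"
    by (simp add: vec_eq_iff matrix_matrix_mult_def mat_def if_distrib if_distribR mult.commute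
        cong: if_cong)
  then show ?thesis
    using assms by (simp add: matrix_mult_diff_distrib)
qed

lemma commute_matrix_mult:
  assumes "A ** X = X ** A" and "A ** Y = Y ** A"
  shows "A ** (X ** Y) = (X ** Y) ** A"
  by (metis assms matrix_mul_assoc)

lemma commute_fixed_defect:
  fixes T X :: "'a::ring_1^'n^'n"
  assumes "T ** X = X ** T"
  shows "T *v (X *v z) - X *v z = X *v (T *v z - z)"
proof -
  have "T *v (X *v z) = X *v (T *v z)"
    using assms by (simp add: matrix_vector_mul_assoc)
  then show ?thesis
    by (simp add: matrix_vector_mult_diff_distrib)
qed

section \<open>Eigenvectors of commuting complex matrices\<close>

lemma cubic_vieta:
  fixes e1 e2 e3 :: complex
  obtains l1 l2 l3 where "l1 + l2 + l3 = e1" "l1 * l2 + l1 * l3 + l2 * l3 = e2" "l1 * l2 * l3 = e3"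
proof -
  obtain root where "smult (lead_coeff [:-e3, e2, -e1, 1:])
      (\<Prod>i<degree [:-e3, e2, -e1, 1:]. [:-root i, 1:]) = [:-e3, e2, -e1, 1:]"
    using complex_poly_decompose' by blast
  then show ?thesis
    by (intro that[of "root 0" "root 1" "root 2"])
      (auto simp: numeral_3_eq_3 numeral_2_eq_2 lessThan_Suc algebra_simps)
qed

lemma cayley_hamilton_3_factored:
  fixes A :: "complex^3^3"
  obtains l1 l2 l3 where "(A - mat l1) ** (A - mat l2) ** (A - mat l3) = 0"
proof -
  obtain l1 l2 l3 where "l1 + l2 + l3 = trace A"
    and "l1 * l2 + l1 * l3 + l2 * l3 =
      A$1$1 * A$2$2 - A$1$2 * A$2$1 + A$1$1 * A$3$3 - A$1$3 * A$3$1 + A$2$2 * A$3$3 - A$2$3 * A$3$2"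
    and "l1 * l2 * l3 = det A"
    by (rule cubic_vieta)
  then have "(A - mat l1) ** (A - mat l2) ** (A - mat l3) = 0"
    unfolding det_3 trace_def sum_3 vec_eq_iff forall_3
    by (simp add: matrix_matrix_mult_def mat_def sum_3) (intro conjI; algebra)
  then show ?thesis
    by (rule that)
qed

lemma eigenvector_in_invariant_subspace:
  fixes A :: "complex^3^3"
  assumes S: "vec.subspace S" "\<forall>y\<in>S. A *v y \<in> S" and x: "x \<in> S" "x \<noteq> 0"
  obtains v l where "v \<in> S" "v \<noteq> 0" "A *v v = l *s v"
proof -
  obtain l1 l2 l3 where "(A - mat l1) ** (A - mat l2) ** (A - mat l3) = 0"
    by (rule cayley_hamilton_3_factored)
  then have annihilated: "(A - mat l1) *v ((A - mat l2) *v ((A - mat l3) *v x)) = 0"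
    by (simp add: matrix_vector_mul_assoc matrix_mul_assoc)
  have closed: "(A - mat l) *v y \<in> S" if "y \<in> S" for l y
    using S that by (simp add: matrix_vector_mult_diff_rdistrib vec.subspace_diff vec.subspace_scale)
  have eigen: "A *v y = l *s y" if "(A - mat l) *v y = 0" for l y
    using that by (simp add: matrix_vector_mult_diff_rdistrib)
  define y where "y = (A - mat l3) *v x"
  define z where "z = (A - mat l2) *v y"
  have "y \<in> S" "z \<in> S"
    unfolding y_def z_def using closed x by blast+
  show ?thesis
  proof (cases "y = 0")
    case True
    then show ?thesis using that[OF x eigen] unfolding y_def by blast
  next
    case y: False
    show ?thesis
    proof (cases "z = 0")
      case True
      then show ?thesis using that[OF \<open>y \<in> S\<close> y eigen] unfolding z_def by blast
    next
      case False
      then show ?thesis using that[OF \<open>z \<in> S\<close> False eigen] annihilated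
        unfolding z_def y_def by blast
    qed
  qed
qed

lemma common_eigenvector_in_invariant_subspace:
  fixes F :: "(complex^3^3) set"
  assumes "finite F" and "\<forall>A\<in>F. \<forall>B\<in>F. A ** B = B ** A"
    and "vec.subspace S" and "\<forall>A\<in>F. \<forall>y\<in>S. A *v y \<in> S" and "x \<in> S" and "x \<noteq> 0"
  shows "\<exists>v\<in>S. v \<noteq> 0 \<and> (\<forall>A\<in>F. \<exists>l. A *v v = l *s v)"
  using assms
proof (induction F arbitrary: S x rule: finite_induct)
  case empty
  then show ?case by blast
next
  case (insert A F)
  have "vec.subspace S" "\<forall>z\<in>S. A *v z \<in> S" "x \<in> S" "x \<noteq> 0"
    using insert.prems by auto
  then obtain y l where y: "y \<in> S" "y \<noteq> 0" "A *v y = l *s y"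
    by (rule eigenvector_in_invariant_subspace)
  define E where "E = {z \<in> S. A *v z = l *s z}"
  have E_eq: "E = S \<inter> {z. (A - mat l) *v z = 0}"
    unfolding E_def by (auto simp: matrix_vector_mult_diff_rdistrib)
  have "vec.subspace {z. (A - mat l) *v z = 0}"
    unfolding vec.subspace_def by (simp add: matrix_vector_right_distrib vector_scalar_commute)
  with \<open>vec.subspace S\<close> have "vec.subspace E"
    unfolding E_eq by (rule vec.subspace_inter)
  moreover have "\<forall>B\<in>F. \<forall>z\<in>E. B *v z \<in> E"
  proof (intro ballI)
    fix B z assume "B \<in> F" "z \<in> E"
    have "A ** B = B ** A"
      using insert.prems(1) \<open>B \<in> F\<close> by blast
    then have "A *v (B *v z) = B *v (A *v z)"
      by (simp add: matrix_vector_mul_assoc)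
    then show "B *v z \<in> E"
      using \<open>B \<in> F\<close> \<open>z \<in> E\<close> insert.prems(3) unfolding E_def
      by (simp add: vector_scalar_commute)
  qed
  ultimately obtain v where "v \<in> E" "v \<noteq> 0" "\<forall>B\<in>F. \<exists>l. B *v v = l *s v"
    using insert.IH[of E y] insert.prems(1) y unfolding E_def by blast
  then show ?case unfolding E_def by auto
qed

section \<open>Simultaneous triangularization\<close>

definition upper_triangular :: "'a::zero^3^3 \<Rightarrow> bool" where
  "upper_triangular A \<longleftrightarrow> A$2$1 = 0 \<and> A$3$1 = 0 \<and> A$3$2 = 0"

lemma upper_triangularI_eigenvectors:
  fixes B :: "'a::semiring_1^3^3"
  assumes "B *v axis 1 1 = l *s axis 1 1" and "axis 3 1 v* B = m *s axis 3 1"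
  shows "upper_triangular B"
  using assms unfolding upper_triangular_def vec_eq_iff forall_3
  by (simp add: matrix_vector_mult_def vector_matrix_mult_def sum_3 axis_def)

lemma adapted_basis_3:
  fixes v w :: "complex^3"
  assumes "v \<noteq> 0" and "w \<noteq> 0" and "scalar_product w v = 0"
  obtains P :: "complex^3^3" where "invertible P" and "P *v axis 1 1 = v" and "w v* P = axis 3 1"
proof -
  \<comment> \<open>The columns of P are v, the cross product of w and conj v, and a multiple of conj w;
    the first two are annihilated by w, so w is the last row of the inverse of P.\<close>
  define v' where "v' = (\<chi> i. cnj (v$i))"
  define w' where "w' = (\<chi> i. cnj (w$i))"
  define c where "c = 1 / scalar_product w w'"
  define u :: "complex^3" where
    "u = vector [w$2 * v'$3 - w$3 * v'$2, w$3 * v'$1 - w$1 * v'$3, w$1 * v'$2 - w$2 * v'$1]"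
  define P :: "complex^3^3" where
    "P = (\<chi> i j. if j = 1 then v$i else if j = 2 then u$i else c * w'$i)"
  have vv: "scalar_product v v' \<noteq> 0" and ww: "scalar_product w w' \<noteq> 0"
    using assms(1,2) unfolding v'_def w'_def scalar_product_cnj_self by simp_all
  have "det P = c * (scalar_product v v' * scalar_product w w'
      - scalar_product w v * scalar_product v' w')"
    unfolding P_def u_def
    by (simp add: det_3 scalar_product_def sum_3; algebra)
  then have "det P = scalar_product v v'"
    using assms(3) ww by (simp add: c_def)
  then have "invertible P"
    using vv by (simp add: invertible_det_nz)
  moreover have "P *v axis 1 1 = v"
    unfolding P_def vec_eq_iff forall_3 by (simp add: matrix_vector_mult_def sum_3 axis_def)
  moreover have "w v* P = axis 3 1"
  proof -
    have "(w v* P)$1 = scalar_product w v" "(w v* P)$3 = c * scalar_product w w'"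
      unfolding P_def by (simp_all add: vector_matrix_mult_def scalar_product_def sum_3 algebra_simps)
    moreover have "(w v* P)$2 = 0"
      unfolding P_def u_def by (simp add: vector_matrix_mult_def sum_3; algebra)
    ultimately show ?thesis
      using assms(3) ww unfolding vec_eq_iff forall_3 by (simp add: axis_def c_def)
  qed
  ultimately show ?thesis
    by (rule that)
qed

lemma common_left_eigenvector_orthogonal:
  fixes F :: "(complex^3^3) set"
  assumes "finite F" and commute: "\<forall>A\<in>F. \<forall>B\<in>F. A ** B = B ** A"
    and "v \<noteq> 0" and v: "\<forall>A\<in>F. \<exists>l. A *v v = l *s v"
  obtains w where "w \<noteq> 0" and "scalar_product w v = 0" and "\<forall>A\<in>F. \<exists>m. w v* A = m *s w"
proof -
  define W where "W = {w. scalar_product w v = 0}"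
  have "vec.subspace W"
    unfolding W_def vec.subspace_def
    by (simp add: scalar_product_def sum.distrib distrib_right mult.assoc flip: sum_distrib_left)
  moreover have "\<forall>A\<in>transpose ` F. \<forall>w\<in>W. A *v w \<in> W"
  proof (intro ballI)
    fix A w assume "A \<in> transpose ` F" "w \<in> W"
    then obtain B l where "A = transpose B" "B *v v = l *s v"
      using v by blast
    have "scalar_product (w v* B) v = scalar_product w (l *s v)"
      by (simp add: scalar_product_vector_matrix_mult \<open>B *v v = l *s v\<close>)
    also have "\<dots> = l * scalar_product w v"
      by (simp add: scalar_product_def sum_distrib_left mult_ac)
    finally show "A *v w \<in> W"
      using \<open>w \<in> W\<close> \<open>A = transpose B\<close> unfolding W_def by simp
  qed
  moreover have "\<forall>A\<in>transpose ` F. \<forall>B\<in>transpose ` F. A ** B = B ** A"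
    using commute by (auto simp: matrix_transpose_mul[symmetric])
  moreover obtain w0 where "w0 \<in> W" "w0 \<noteq> 0"
  proof (cases "v$1 = 0")
    case True
    then show ?thesis
      by (intro that[of "axis 1 1"]) (auto simp: W_def scalar_product_def sum_3 axis_def vec_eq_iff)
  next
    case False
    then show ?thesis
      by (intro that[of "vector [- v$2, v$1, 0]"])
        (auto simp: W_def scalar_product_def sum_3 vec_eq_iff forall_3 algebra_simps)
  qed
  ultimately show ?thesis
    using common_eigenvector_in_invariant_subspace[of "transpose ` F" W w0] \<open>finite F\<close> that
    unfolding W_def by auto
qed

lemma upper_triangular_conjugate:
  fixes A P :: "'a::field^3^3"
  assumes "invertible P" and "P *v axis 1 1 = v" and "w v* P = axis 3 1"
    and "A *v v = l *s v" and "w v* A = m *s w"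
  shows "upper_triangular (matrix_inv P ** A ** P)"
proof -
  have "matrix_inv P *v v = axis 1 1"
    by (metis assms(2) invertible_matrix_inv(2)[OF assms(1)] matrix_vector_mul_assoc
        matrix_vector_mul_lid)
  moreover have "axis 3 1 v* matrix_inv P = w"
    by (metis assms(3) invertible_matrix_inv(1)[OF assms(1)] vector_matrix_mul_assoc
        vector_matrix_mul_rid)
  ultimately have "(matrix_inv P ** A ** P) *v axis 1 1 = l *s axis 1 1"
    and "axis 3 1 v* (matrix_inv P ** A ** P) = m *s axis 3 1"
    using assms(2-5) by (simp_all add: vector_scalar_commute scalar_vector_matrix_assoc
        flip: matrix_vector_mul_assoc vector_matrix_mul_assoc)
  then show ?thesis
    by (rule upper_triangularI_eigenvectors)
qed

lemma simultaneous_triangularization: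
  fixes F :: "(complex^3^3) set"
  assumes "finite F" and commute: "\<forall>A\<in>F. \<forall>B\<in>F. A ** B = B ** A"
  obtains P :: "complex^3^3"
  where "invertible P" and "\<forall>A\<in>F. upper_triangular (matrix_inv P ** A ** P)"
proof -
  have "axis 1 1 \<noteq> (0 :: complex^3)"
    by (simp add: axis_eq_0_iff)
  then obtain v where v: "v \<noteq> 0" "\<forall>A\<in>F. \<exists>l. A *v v = l *s v"
    using common_eigenvector_in_invariant_subspace[of F UNIV "axis 1 1"] assms by auto
  obtain w where w: "w \<noteq> 0" "scalar_product w v = 0" "\<forall>A\<in>F. \<exists>m. w v* A = m *s w"
    by (rule common_left_eigenvector_orthogonal[OF assms v])
  obtain P :: "complex^3^3" where P: "invertible P" "P *v axis 1 1 = v" "w v* P = axis 3 1"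
    by (rule adapted_basis_3[OF v(1) w(1,2)])
  have "\<forall>A\<in>F. upper_triangular (matrix_inv P ** A ** P)"
    using upper_triangular_conjugate[OF P] v(2) w(3) by blast
  with P(1) show ?thesis
    by (rule that)
qed

section \<open>Upper triangular matrices\<close>

lemma upper_triangular_mult:
  assumes "upper_triangular A" and "upper_triangular B"
  shows "upper_triangular (A ** B)" and "(A ** B)$i$i = A$i$i * B$i$i"
  using assms exhaust_3[of i] unfolding upper_triangular_def
  by (auto simp: matrix_matrix_mult_def sum_3)

lemma upper_triangular_left_inverse:
  fixes X Y :: "'a::idom^3^3"
  assumes X: "upper_triangular X" and YX: "Y ** X = mat 1"
  shows "upper_triangular Y"
proof -
  have entry: "(Y ** X)$i$j = (if i = j then 1 else 0)" for i j
    using YX by (simp add: mat_def)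
  have "Y$1$1 * X$1$1 = 1" "Y$2$1 * X$1$1 = 0" "Y$3$1 * X$1$1 = 0"
    using entry[of 1 1] entry[of 2 1] entry[of 3 1] X
    by (simp_all add: upper_triangular_def matrix_matrix_mult_def sum_3)
  then have col1: "Y$2$1 = 0" "Y$3$1 = 0"
    by (metis mult_eq_0_iff zero_neq_one)+
  have "Y$2$2 * X$2$2 = 1" "Y$3$2 * X$2$2 = 0"
    using entry[of 2 2] entry[of 3 2] X col1
    by (simp_all add: upper_triangular_def matrix_matrix_mult_def sum_3)
  then have "Y$3$2 = 0"
    by (metis mult_eq_0_iff zero_neq_one)
  with col1 show ?thesis
    by (simp add: upper_triangular_def)
qed

lemma upper_triangular_fixed_vector_diag:
  fixes T :: "'a::field^3^3"
  assumes "upper_triangular T" and "T *v y = y" and "y \<noteq> 0"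
  obtains i where "T$i$i = 1"
proof -
  have "det (T - mat 1) = 0"
    using det_eq_0_if_kernel[of "T - mat 1" y] assms(2,3) by (simp add: matrix_vector_mult_diff_rdistrib)
  moreover have "det (T - mat 1) = (T$1$1 - 1) * (T$2$2 - 1) * (T$3$3 - 1)"
    using assms(1) by (simp add: det_3 upper_triangular_def mat_def)
  ultimately show ?thesis
    using that by auto
qed

lemma upper_triangular_eq_if_commute:
  fixes X Y :: "'a::idom^3^3"
  assumes "upper_triangular X" and "upper_triangular Y" and diag: "\<forall>i. X$i$i = Y$i$i"
    and G: "\<forall>G\<in>{G1, G2, G3}. upper_triangular G \<and> G ** X = X ** G \<and> G ** Y = Y ** G"
    and "G1$1$1 \<noteq> G1$2$2" and "G2$2$2 \<noteq> G2$3$3" and "G3$1$1 \<noteq> G3$3$3"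
  shows "X = Y"
proof -
  define D where "D = X - Y"
  have D: "D$2$1 = 0" "D$3$1 = 0" "D$3$2 = 0" "\<forall>i. D$i$i = 0"
    using assms(1,2) diag unfolding D_def upper_triangular_def by simp_all
  have commute: "(G ** D)$i$j = (D ** G)$i$j" if "G \<in> {G1, G2, G3}" for G i j
  proof -
    have "G ** D = D ** G"
      using G that unfolding D_def by (auto simp: matrix_mult_diff_distrib)
    then show ?thesis by simp
  qed
  have G_ut: "G$2$1 = 0" "G$3$1 = 0" "G$3$2 = 0" if "G \<in> {G1, G2, G3}" for G
    using G that unfolding upper_triangular_def by auto
  have "(G1$1$1 - G1$2$2) * D$1$2 = 0"
    using commute[of G1 1 2] G_ut[of G1] D by (simp add: matrix_matrix_mult_def sum_3 algebra_simps)
  then have D12: "D$1$2 = 0"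
    using assms(5) by simp
  have "(G2$2$2 - G2$3$3) * D$2$3 = 0"
    using commute[of G2 2 3] G_ut[of G2] D by (simp add: matrix_matrix_mult_def sum_3 algebra_simps)
  then have D23: "D$2$3 = 0"
    using assms(6) by simp
  have "(G3$1$1 - G3$3$3) * D$1$3 = 0"
    using commute[of G3 1 3] G_ut[of G3] D D12 D23
    by (simp add: matrix_matrix_mult_def sum_3 algebra_simps)
  then have "D$1$3 = 0"
    using assms(7) by simp
  with D D12 D23 have "D = 0"
    by (simp add: vec_eq_iff forall_3)
  then show ?thesis
    unfolding D_def by simp
qed

lemma upper_triangular_diff_mat:
  fixes A :: "'a::ab_group_add^3^3"
  shows "upper_triangular A \<Longrightarrow> upper_triangular (A - mat c) \<and> (A - mat c)$i$i = A$i$i - c"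
  by (simp add: upper_triangular_def mat_def)

lemma upper_triangular_annihilator:
  fixes A B :: "'a::field^3^3"
  assumes ut: "upper_triangular A" "upper_triangular B" and AB: "A ** B = B ** A"
    and j: "\<not> (A$j$j = 1 \<and> B$j$j = 1)" and k: "A$k$k = 1" "B$k$k = 1"
  obtains X where "upper_triangular X" "X$j$j = 0" "X$k$k \<noteq> 0"
    and "A ** X = X ** A" "B ** X = X ** B"
proof (cases "A$j$j = 1")
  case False
  show ?thesis
    by (rule that[of "A - mat (A$j$j)"])
      (use ut AB k False upper_triangular_diff_mat[OF ut(1)] commute_diff_mat[of A A]
        commute_diff_mat[of B A] in auto)
next
  case True
  with j have "B$j$j \<noteq> 1" by simp
  show ?thesis
    by (rule that[of "B - mat (B$j$j)"])
      (use ut AB k \<open>B$j$j \<noteq> 1\<close> upper_triangular_diff_mat[OF ut(2)] commute_diff_mat[of B B]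
        commute_diff_mat[of A B] in auto)
qed

lemma upper_triangular_common_fixed_vector:
  fixes A B :: "'a::field^3^3"
  assumes ut: "upper_triangular A" "upper_triangular B" and AB: "A ** B = B ** A"
    and k: "A$k$k = 1" "B$k$k = 1"
  obtains y where "y \<noteq> 0" and "A *v y = y" and "B *v y = y"
proof -
  \<comment> \<open>If p is the first position where both diagonals are 1, the fixed vector is X e_p for
    a product X of matrices A - a or B - b that commute with A and B and whose diagonals vanish at
    the positions before p but not at p.\<close>
  consider "A$1$1 = 1 \<and> B$1$1 = 1"
    | "\<not> (A$1$1 = 1 \<and> B$1$1 = 1)" "A$2$2 = 1 \<and> B$2$2 = 1"
    | "\<not> (A$1$1 = 1 \<and> B$1$1 = 1)" "\<not> (A$2$2 = 1 \<and> B$2$2 = 1)" "A$3$3 = 1 \<and> B$3$3 = 1"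
    using k exhaust_3[of k] by auto
  then show ?thesis
  proof cases
    case 1
    then show ?thesis
      using ut by (intro that[of "axis 1 1"])
        (auto simp: vec_eq_iff forall_3 matrix_vector_mult_def sum_3 axis_def upper_triangular_def)
  next
    case 2
    obtain X where X: "upper_triangular X" "X$1$1 = 0" "X$2$2 \<noteq> 0"
      and XA: "A ** X = X ** A" and XB: "B ** X = X ** B"
      using upper_triangular_annihilator[OF ut AB 2(1)] 2(2) by blast
    define y where "y = X *v axis 2 1"
    have "y$2 \<noteq> 0"
      using X unfolding y_def by (simp add: matrix_vector_mult_def sum_3 axis_def upper_triangular_def)
    moreover have "A *v y - y = 0" "B *v y - y = 0"
      unfolding y_def commute_fixed_defect[OF XA] commute_fixed_defect[OF XB]
      using ut 2(2) X
      by (auto simp: vec_eq_iff forall_3 matrix_vector_mult_def sum_3 axis_def upper_triangular_def)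
    ultimately show ?thesis
      by (intro that[of y]) auto
  next
    case 3
    obtain X where X: "upper_triangular X" "X$1$1 = 0" "X$3$3 \<noteq> 0"
      and XA: "A ** X = X ** A" and XB: "B ** X = X ** B"
      using upper_triangular_annihilator[OF ut AB 3(1)] 3(3) by blast
    obtain Y where Y: "upper_triangular Y" "Y$2$2 = 0" "Y$3$3 \<noteq> 0"
      and YA: "A ** Y = Y ** A" and YB: "B ** Y = Y ** B"
      using upper_triangular_annihilator[OF ut AB 3(2)] 3(3) by blast
    define y where "y = X *v (Y *v axis 3 1)"
    have "y$3 \<noteq> 0"
      using X Y unfolding y_def by (simp add: matrix_vector_mult_def sum_3 axis_def upper_triangular_def)
    moreover have "A *v y - y = 0" "B *v y - y = 0"
      unfolding y_def commute_fixed_defect[OF XA] commute_fixed_defect[OF XB]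
        commute_fixed_defect[OF YA] commute_fixed_defect[OF YB]
      using ut 3(3) X Y
      by (auto simp: vec_eq_iff forall_3 matrix_vector_mult_def sum_3 axis_def upper_triangular_def)
    ultimately show ?thesis
      by (intro that[of y]) auto
  qed
qed

section \<open>Characters whose kernels cover a monoid\<close>

definition character :: "('a::monoid_add \<Rightarrow> 'b::idom) \<Rightarrow> bool" where
  "character f \<longleftrightarrow> (\<forall>x y. f (x + y) = f x * f y) \<and> (\<forall>x. f x \<noteq> 0)"

definition submonoid_add :: "'a::monoid_add set \<Rightarrow> bool" where
  "submonoid_add H \<longleftrightarrow> 0 \<in> H \<and> (\<forall>x\<in>H. \<forall>y\<in>H. x + y \<in> H)"

lemma character_0: "character f \<Longrightarrow> f 0 = 1"
  unfolding character_def by (metis add_0 mult_cancel_left2)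

lemma character_kernels_cover_two:
  assumes "character f" and "character g" and "submonoid_add H"
    and cover: "\<forall>x\<in>H. f x = 1 \<or> g x = 1"
  shows "(\<forall>x\<in>H. f x = 1) \<or> (\<forall>x\<in>H. g x = 1)"
proof (rule ccontr)
  assume "\<not> ?thesis"
  then obtain x y where "x \<in> H" "y \<in> H" "f x \<noteq> 1" "g y \<noteq> 1"
    by auto
  moreover from this have "g x = 1" "f y = 1"
    using cover by auto
  ultimately have "x + y \<in> H" "f (x + y) \<noteq> 1" "g (x + y) \<noteq> 1"
    using assms(1-3) unfolding character_def submonoid_add_def by auto
  with cover show False
    by blast
qed

lemma character_kernels_cover_exclusive:
  assumes "character f1" and "character f2" and "character f3" and "submonoid_add H"
    and cover: "\<forall>x\<in>H. f1 x = 1 \<or> f2 x = 1 \<or> f3 x = 1"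
    and "\<exists>x\<in>H. f2 x \<noteq> 1" and "\<exists>x\<in>H. f3 x \<noteq> 1"
  obtains x where "x \<in> H" and "f1 x = 1" and "f2 x \<noteq> 1" and "f3 x \<noteq> 1"
proof -
  have "\<not> (\<forall>x\<in>H. f2 x = 1 \<or> f3 x = 1)"
    using character_kernels_cover_two[OF assms(2-4)] assms(6,7) by blast
  then show ?thesis
    using cover that by blast
qed

lemma character_kernels_cover_distinct:
  assumes "character f" and "character g" and "character k" and "submonoid_add H"
    and cover: "\<forall>x\<in>H. f x = 1 \<or> g x = 1 \<or> k x = 1"
    and "\<exists>x\<in>H. f x \<noteq> 1" and "\<exists>x\<in>H. k x \<noteq> 1"
  obtains h where "h \<in> H" and "f h \<noteq> g h"
proof -
  have "\<not> (\<forall>x\<in>H. f x = 1 \<or> k x = 1)"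
    using character_kernels_cover_two[OF assms(1,3,4)] assms(6,7) by blast
  then show ?thesis
    using cover that by auto
qed

lemma character_kernels_cover_decomposition_of_kernel:
  assumes chars: "character f1" "character f2" "character f3" and "submonoid_add H"
    and cover: "\<forall>x. f1 x = 1 \<or> f2 x = 1 \<or> f3 x = 1"
    and nontrivial: "\<exists>x\<in>H. f1 x \<noteq> 1" "\<exists>x\<in>H. f2 x \<noteq> 1" "\<exists>x\<in>H. f3 x \<noteq> 1"
    and "f1 c = 1"
  obtains h where "h \<in> H" and "f1 c = f1 h" and "f2 c = f2 h" and "f3 c = f3 h"
proof -
  have mult: "f1 (x + y) = f1 x * f1 y" "f2 (x + y) = f2 x * f2 y" "f3 (x + y) = f3 x * f3 y"
    "f1 x \<noteq> 0" "f2 x \<noteq> 0" "f3 x \<noteq> 0" for x y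
    using chars unfolding character_def by auto
  have UNIV: "submonoid_add (UNIV :: 'a set)"
    by (simp add: submonoid_add_def)
  obtain x2 where x2: "f2 x2 = 1" "f1 x2 \<noteq> 1" "f3 x2 \<noteq> 1"
    using character_kernels_cover_exclusive[OF chars(2,1,3) UNIV] cover nontrivial by blast
  obtain x3 where x3: "f3 x3 = 1" "f1 x3 \<noteq> 1" "f2 x3 \<noteq> 1"
    using character_kernels_cover_exclusive[OF chars(3,1,2) UNIV] cover nontrivial by blast
  show ?thesis
  proof (cases "f2 c = 1 \<or> f3 c = 1")
    case True
    then have "f2 c = 1 \<and> f3 c = 1"
      using cover[rule_format, of "x3 + c"] cover[rule_format, of "x2 + c"] x2 x3 \<open>f1 c = 1\<close>
      by (auto simp: mult)
    then show ?thesis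
      using that \<open>f1 c = 1\<close> \<open>submonoid_add H\<close> character_0[OF chars(1)]
        character_0[OF chars(2)] character_0[OF chars(3)]
      unfolding submonoid_add_def by auto
  next
    case False
    obtain h where h: "h \<in> H" "f1 h = 1" "f2 h \<noteq> 1" "f3 h \<noteq> 1"
      using character_kernels_cover_exclusive[OF chars \<open>submonoid_add H\<close>] cover nontrivial
      by blast
    have "f3 (x2 + c) = 1" "f3 (x2 + h) = 1" "f2 (x3 + c) = 1" "f2 (x3 + h) = 1"
      using cover[rule_format, of "x2 + c"] cover[rule_format, of "x2 + h"]
        cover[rule_format, of "x3 + c"] cover[rule_format, of "x3 + h"]
        x2 x3 h False \<open>f1 c = 1\<close> by (auto simp: mult)
    then have "f3 x2 * f3 c = f3 x2 * f3 h" "f2 x3 * f2 c = f2 x3 * f2 h"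
      by (simp_all add: mult)
    then have "f3 c = f3 h" "f2 c = f2 h"
      using mult(5,6) by simp_all
    then show ?thesis
      using that h \<open>f1 c = 1\<close> by auto
  qed
qed

lemma character_kernels_cover_decomposition:
  assumes chars: "character f1" "character f2" "character f3" and "submonoid_add H"
    and cover: "\<forall>x. f1 x = 1 \<or> f2 x = 1 \<or> f3 x = 1"
    and nontrivial: "\<exists>x\<in>H. f1 x \<noteq> 1" "\<exists>x\<in>H. f2 x \<noteq> 1" "\<exists>x\<in>H. f3 x \<noteq> 1"
  obtains h where "h \<in> H" and "f1 c = f1 h" and "f2 c = f2 h" and "f3 c = f3 h"
proof -
  consider "f1 c = 1" | "f2 c = 1" | "f3 c = 1"
    using cover by blast
  then show ?thesis
  proof cases
    case 1
    show ?thesis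
      by (rule character_kernels_cover_decomposition_of_kernel[OF assms 1]) (rule that)
  next
    case 2
    show ?thesis
      by (rule character_kernels_cover_decomposition_of_kernel[OF chars(2,1,3) \<open>submonoid_add H\<close> _
            nontrivial(2,1,3) 2])
        (use cover that in blast)+
  next
    case 3
    show ?thesis
      by (rule character_kernels_cover_decomposition_of_kernel[OF chars(3,1,2) \<open>submonoid_add H\<close> _
            nontrivial(3,1,2) 3])
        (use cover that in blast)+
  qed
qed

section \<open>Integer matrices\<close>

lemma map_matrix_of_int_mult:
  "map_matrix of_int (A ** B) = map_matrix of_int A ** (map_matrix of_int B :: 'a::comm_ring_1^_^_)"
  by (simp add: vec_eq_iff matrix_matrix_mult_def)

lemma map_matrix_of_int_mat_1: "map_matrix of_int (mat 1) = (mat 1 :: 'a::ring_1^_^_)"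
  by (simp add: vec_eq_iff mat_def)

lemma map_matrix_of_int_inject:
  "map_matrix of_int A = (map_matrix of_int B :: 'a::ring_char_0^_^_) \<longleftrightarrow> A = B"
  by (simp add: vec_eq_iff map_matrix_def)

lemma GL3Z_matrix_inv:
  assumes "A \<in> GL3Z"
  shows "A ** matrix_inv A = mat 1" and "matrix_inv A ** A = mat 1"
  using assms invertible_matrix_inv unfolding GL3Z_def by auto

lemma mpow_in_gen_subgroup:
  assumes "A \<in> S"
  shows "mpow A n \<in> gen_subgroup S"
proof -
  have "((**) B ^^ j) (mat 1) \<in> gen_subgroup S" if "B \<in> gen_subgroup S" for B j
    using that by (induction j) (auto intro: gen_subgroup.intros)
  moreover have "A \<in> gen_subgroup S" "matrix_inv A \<in> gen_subgroup S"
    using assms by (auto intro: gen_subgroup.intros)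
  ultimately show ?thesis
    unfolding mpow_def by auto
qed

lemma iterated_mult_commute:
  assumes "A ** B = B ** A"
  shows "((**) A ^^ j) (mat 1) ** B = B ** ((**) A ^^ j) (mat 1)"
  by (induction j) (simp_all, metis assms matrix_mul_assoc)

lemma mpow_commute:
  assumes "A \<in> GL3Z" and "A ** B = B ** A"
  shows "mpow A n ** B = B ** mpow A n"
proof -
  have "matrix_inv A ** B = matrix_inv A ** B ** (A ** matrix_inv A)"
    using GL3Z_matrix_inv[OF assms(1)] by simp
  also have "\<dots> = matrix_inv A ** (A ** B) ** matrix_inv A"
    by (simp add: assms(2) matrix_mul_assoc)
  also have "\<dots> = B ** matrix_inv A"
    using GL3Z_matrix_inv[OF assms(1)] by (simp add: matrix_mul_assoc)
  finally show ?thesis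
    using assms(2) iterated_mult_commute unfolding mpow_def by auto
qed

lemma mpow_fixed_vector:
  assumes "A \<in> GL3Z" and "A *v k = k"
  shows "mpow A n *v k = k"
proof -
  have iterate: "((**) B ^^ j) (mat 1) *v k = k" if "B *v k = k" for B j
    using that by (induction j) (auto simp flip: matrix_vector_mul_assoc)
  have "matrix_inv A *v k = k"
    using GL3Z_matrix_inv[OF assms(1)] assms(2) by (metis matrix_vector_mul_assoc matrix_vector_mul_lid)
  then show ?thesis
    using iterate assms(2) unfolding mpow_def by auto
qed

lemma mpow_0 [simp]: "mpow A 0 = mat 1" and mpow_1 [simp]: "mpow A 1 = A"
  by (simp_all add: mpow_def)

context
  fixes \<phi> :: "imat3 \<Rightarrow> 'a::field^3^3"
  assumes \<phi>_mult: "\<And>A B. \<phi> (A ** B) = \<phi> A ** \<phi> B" and \<phi>_one: "\<phi> (mat 1) = mat 1"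
begin

lemma upper_triangular_hom_inverse:
  assumes "A \<in> GL3Z" and "upper_triangular (\<phi> A)"
  shows "upper_triangular (\<phi> (matrix_inv A))" and "\<phi> (matrix_inv A)$i$i * \<phi> A$i$i = 1"
proof -
  have inv: "\<phi> (matrix_inv A) ** \<phi> A = mat 1"
    using GL3Z_matrix_inv[OF assms(1)] by (simp flip: \<phi>_mult add: \<phi>_one)
  then show ut: "upper_triangular (\<phi> (matrix_inv A))"
    using assms(2) by (rule upper_triangular_left_inverse[rotated])
  show "\<phi> (matrix_inv A)$i$i * \<phi> A$i$i = 1"
    using upper_triangular_mult(2)[OF ut assms(2), of i] inv by (simp add: mat_def)
qed

lemma upper_triangular_hom_iterate:
  assumes "upper_triangular (\<phi> B)"
  shows "upper_triangular (\<phi> (((**) B ^^ j) (mat 1)))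
    \<and> \<phi> (((**) B ^^ j) (mat 1))$i$i = \<phi> B$i$i ^ j"
proof (induction j)
  case 0
  then show ?case
    by (simp add: \<phi>_one) (simp add: upper_triangular_def mat_def)
next
  case (Suc j)
  then show ?case
    using upper_triangular_mult[OF assms] by (simp add: \<phi>_mult)
qed

lemma upper_triangular_hom_mpow:
  assumes "A \<in> GL3Z" and "upper_triangular (\<phi> A)"
  shows "upper_triangular (\<phi> (mpow A n))" and "\<phi> (mpow A n)$i$i = \<phi> A$i$i powi n"
proof -
  have "\<phi> (matrix_inv A)$i$i = inverse (\<phi> A$i$i)"
    using upper_triangular_hom_inverse(2)[OF assms] by (metis inverse_unique mult.commute)
  then show "upper_triangular (\<phi> (mpow A n))" "\<phi> (mpow A n)$i$i = \<phi> A$i$i powi n"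
    using upper_triangular_hom_iterate[OF assms(2)]
      upper_triangular_hom_iterate[OF upper_triangular_hom_inverse(1)[OF assms]]
    by (auto simp: mpow_def power_int_def power_inverse)
qed

end

lemma integer_common_kernel_3:
  fixes R :: "(int^3) set" and v :: "complex^3"
  assumes "v \<noteq> 0" and R: "\<forall>r\<in>R. scalar_product (\<chi> i. of_int (r$i)) v = 0"
  obtains k where "k \<noteq> 0" and "\<forall>r\<in>R. scalar_product r k = 0"
proof -
  \<comment> \<open>The complex matrix with rows r, s, t from R kills v, so the triple product of r, s, t
    vanishes. Hence a nonzero cross product of two vectors of R will do; if there is none, all of
    R is parallel to one r, and a nonzero cross product of r and a unit vector will do.\<close>
  define cross :: "int^3 \<Rightarrow> int^3 \<Rightarrow> int^3" where
    "cross r s = vector [r$2 * s$3 - r$3 * s$2, r$3 * s$1 - r$1 * s$3, r$1 * s$2 - r$2 * s$1]" for r s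
  have triple: "scalar_product t (cross r s) = 0" if "r \<in> R" "s \<in> R" "t \<in> R" for r s t
  proof -
    define S :: "complex^3^3" where
      "S = (\<chi> i j. of_int ((if i = 1 then r else if i = 2 then s else t)$j))"
    have "S *v v = 0"
      using R that unfolding S_def by (simp add: vec_eq_iff forall_3 matrix_vector_mult_def scalar_product_def)
    then have "det S = 0"
      using \<open>v \<noteq> 0\<close> by (rule det_eq_0_if_kernel)
    then have "of_int (scalar_product t (cross r s)) = (0::complex)"
      unfolding S_def cross_def by (simp add: det_3 scalar_product_def sum_3 algebra_simps)
    then show ?thesis
      by simp
  qed
  show ?thesis
  proof (cases "\<exists>r\<in>R. \<exists>s\<in>R. cross r s \<noteq> 0")
    case True
    then show ?thesis
      using triple that by blast
  next
    case parallel: False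
    show ?thesis
    proof (cases "\<forall>r\<in>R. r = 0")
      case True
      then show ?thesis
        by (intro that[of "axis 1 1"]) (auto simp: scalar_product_def)
    next
      case False
      then obtain r where r: "r \<in> R" "r \<noteq> 0"
        by blast
      have "\<exists>j. cross r (axis j 1) \<noteq> 0"
      proof (rule ccontr)
        assume "\<nexists>j. cross r (axis j 1) \<noteq> 0"
        then have "cross r (axis 1 1) = 0" "cross r (axis 2 1) = 0" "cross r (axis 3 1) = 0"
          by auto
        then have "r = 0"
          by (simp add: cross_def vec_eq_iff forall_3 axis_def)
        with r show False
          by simp
      qed
      then obtain j where j: "cross r (axis j 1) \<noteq> 0"
        by blast
      have "scalar_product t (cross r (axis j 1)) = scalar_product (cross t r) (axis j 1)" for t
        by (simp add: cross_def scalar_product_def sum_3 algebra_simps)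
      then show ?thesis
        using parallel r j by (intro that[of "cross r (axis j 1)"]) (auto simp: scalar_product_def)
    qed
  qed
qed

lemma integer_common_fixed_vector:
  fixes F :: "imat3 set" and v :: "complex^3"
  assumes "v \<noteq> 0" and fixed: "\<forall>A\<in>F. map_matrix of_int A *v v = v"
  obtains k :: "int^3" where "k \<noteq> 0" and "\<forall>A\<in>F. A *v k = k"
proof -
  define R where "R = {row i A - axis i 1 | A i. A \<in> F}"
  have "(\<chi> j. of_int ((row i A - axis i 1)$j)) = row i (map_matrix of_int A) - axis i (1::complex)"
    for i and A :: imat3
    by (simp add: vec_eq_iff row_def axis_def)
  then have "\<forall>r\<in>R. scalar_product (\<chi> i. of_int (r$i)) v = 0"
    using fixed unfolding R_def by (auto simp: scalar_product_row_minus_axis)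
  then obtain k where k: "k \<noteq> 0" "\<forall>r\<in>R. scalar_product r k = 0"
    using integer_common_kernel_3 \<open>v \<noteq> 0\<close> by blast
  have "A *v k = k" if "A \<in> F" for A
  proof -
    have "(A *v k)$i - k$i = 0" for i
      using k(2) that unfolding R_def by (auto simp flip: scalar_product_row_minus_axis)
    then show ?thesis
      by (simp add: vec_eq_iff)
  qed
  with k(1) show ?thesis
    using that by blast
qed

section \<open>Characters of a simultaneously triangularized triple\<close>

locale triangularized_triple =
  fixes N M C :: imat3 and P :: "complex^3^3"
  assumes GL3Z: "N \<in> GL3Z" "M \<in> GL3Z" "C \<in> GL3Z"
    and commute: "N ** M = M ** N" "C ** N = N ** C" "C ** M = M ** C"
    and invertible_P: "invertible P"
    and triangular: "\<forall>A\<in>{N, M, C}. upper_triangular (matrix_inv P ** map_matrix of_int A ** P)"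
begin

definition rep :: "imat3 \<Rightarrow> complex^3^3" where
  "rep A = matrix_inv P ** map_matrix of_int A ** P"

definition word :: "int \<times> int \<times> int \<Rightarrow> imat3" where
  "word x = (case x of (n, m, s) \<Rightarrow> mpow N n ** mpow M m ** mpow C s)"

definition diag_char :: "3 \<Rightarrow> int \<times> int \<times> int \<Rightarrow> complex" where
  "diag_char i x =
    (case x of (n, m, s) \<Rightarrow> rep N$i$i powi n * rep M$i$i powi m * rep C$i$i powi s)"

lemma rep_mult: "rep (A ** B) = rep A ** rep B"
proof -
  have "matrix_inv P ** map_matrix of_int A ** map_matrix of_int B ** P
      = matrix_inv P ** map_matrix of_int A ** (P ** matrix_inv P) ** map_matrix of_int B ** P"
    by (simp add: invertible_matrix_inv(1)[OF invertible_P])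
  then show ?thesis
    unfolding rep_def map_matrix_of_int_mult by (simp add: matrix_mul_assoc)
qed

lemma rep_mat_1: "rep (mat 1) = mat 1"
  unfolding rep_def map_matrix_of_int_mat_1 by (simp add: invertible_matrix_inv(2)[OF invertible_P])

lemma rep_intertwines: "map_matrix of_int A ** P = P ** rep A"
proof -
  have "P ** rep A = (P ** matrix_inv P) ** map_matrix of_int A ** P"
    unfolding rep_def by (simp only: matrix_mul_assoc)
  then show ?thesis
    by (simp add: invertible_matrix_inv(1)[OF invertible_P])
qed

lemma rep_fixed_vector_iff: "rep A *v y = y \<longleftrightarrow> map_matrix of_int A *v (P *v y) = P *v y"
proof -
  have "map_matrix of_int A *v (P *v y) = P *v (rep A *v y)"
    by (simp add: matrix_vector_mul_assoc rep_intertwines)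
  then show ?thesis
    using inj_matrix_vector_mult[OF invertible_P] by (auto dest: injD)
qed

lemma rep_inject: "rep A = rep B \<longleftrightarrow> A = B"
proof
  assume "rep A = rep B"
  then have "map_matrix of_int A ** P ** matrix_inv P = map_matrix of_int B ** P ** matrix_inv P"
    by (simp add: rep_intertwines)
  then show "A = B"
    by (simp add: invertible_matrix_inv(1)[OF invertible_P] map_matrix_of_int_inject
        flip: matrix_mul_assoc)
qed simp

lemma upper_triangular_rep_mpow:
  assumes "A \<in> {N, M, C}"
  shows "upper_triangular (rep (mpow A n))" and "rep (mpow A n)$i$i = rep A$i$i powi n"
  using upper_triangular_hom_mpow[OF rep_mult rep_mat_1] GL3Z triangular assms
  unfolding rep_def by auto

lemma upper_triangular_rep_word:
  shows "upper_triangular (rep (word x))" and "rep (word x)$i$i = diag_char i x"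
proof -
  obtain n m s where x: "x = (n, m, s)"
    by (cases x)
  have ut: "upper_triangular (rep (mpow N n))" "upper_triangular (rep (mpow M m))"
    "upper_triangular (rep (mpow C s))"
    using upper_triangular_rep_mpow(1) by auto
  have ut_NM: "upper_triangular (rep (mpow N n) ** rep (mpow M m))"
    using upper_triangular_mult(1)[OF ut(1,2)] .
  show "upper_triangular (rep (word x))"
    using upper_triangular_mult(1)[OF ut_NM ut(3)] by (simp add: x word_def rep_mult)
  show "rep (word x)$i$i = diag_char i x"
    using upper_triangular_mult(2)[OF ut_NM ut(3)] upper_triangular_mult(2)[OF ut(1,2)]
    by (simp add: x word_def diag_char_def rep_mult upper_triangular_rep_mpow(2))
qed

lemma character_diag_char: "character (diag_char i)"
proof -
  have "rep A$i$i \<noteq> 0" if "A \<in> {N, M, C}" for A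
    using upper_triangular_hom_inverse(2)[OF rep_mult rep_mat_1, of A i] GL3Z triangular that
    unfolding rep_def by auto
  then show ?thesis
    unfolding character_def diag_char_def by (auto simp: power_int_add split: prod.split)
qed

lemma word_commute: "word x ** word y = word y ** word x"
proof -
  have commute_word: "A ** word x = word x ** A"
    if "A ** N = N ** A" "A ** M = M ** A" "A ** C = C ** A" for A x
  proof -
    obtain n m s where x: "x = (n, m, s)"
      by (cases x)
    have "A ** mpow N n = mpow N n ** A" "A ** mpow M m = mpow M m ** A"
      "A ** mpow C s = mpow C s ** A"
      using that mpow_commute[OF GL3Z(1)] mpow_commute[OF GL3Z(2)] mpow_commute[OF GL3Z(3)] by metis+
    then show ?thesis
      unfolding x word_def by (simp add: commute_matrix_mult)
  qed
  have "word y ** N = N ** word y" "word y ** M = M ** word y" "word y ** C = C ** word y"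
    using commute_word[of N] commute_word[of M] commute_word[of C] commute by metis+
  then show ?thesis
    using commute_word by metis
qed

lemma diag_char_cover:
  assumes "\<forall>n m s. eig1 (mpow N n ** mpow M m ** mpow C s)"
  shows "\<exists>i. diag_char i x = 1"
proof -
  obtain n m s where "x = (n, m, s)"
    by (cases x)
  then have "eig1 (word x)"
    using assms by (simp add: word_def)
  then obtain v :: "complex^3" where "v \<noteq> 0" "map_matrix of_int (word x) *v v = v"
    unfolding eig1_def map_matrix_def by blast
  moreover have "P *v (matrix_inv P *v v) = v"
    by (simp add: matrix_vector_mul_assoc invertible_matrix_inv(1)[OF invertible_P])
  ultimately have "rep (word x) *v (matrix_inv P *v v) = matrix_inv P *v v"
    and "matrix_inv P *v v \<noteq> 0"
    by (auto simp: rep_fixed_vector_iff)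
  then obtain i where "rep (word x)$i$i = 1"
    using upper_triangular_fixed_vector_diag upper_triangular_rep_word(1) by blast
  then show ?thesis
    using upper_triangular_rep_word(2) by auto
qed

lemma diag_char_nontrivial:
  assumes "{k :: int^3. \<forall>n m. (mpow N n ** mpow M m) *v k = k} = {0}"
  shows "\<exists>n m. diag_char i (n, m, 0) \<noteq> 1"
proof (rule ccontr)
  assume "\<nexists>n m. diag_char i (n, m, 0) \<noteq> 1"
  then have "diag_char i (1, 0, 0) = 1" "diag_char i (0, 1, 0) = 1"
    by blast+
  then have "rep N$i$i = 1" "rep M$i$i = 1"
    by (simp_all add: diag_char_def)
  moreover have "upper_triangular (rep N)" "upper_triangular (rep M)"
    using triangular unfolding rep_def by auto
  moreover have "rep N ** rep M = rep M ** rep N"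
    by (simp add: commute(1) flip: rep_mult)
  ultimately obtain y where y: "y \<noteq> 0" "rep N *v y = y" "rep M *v y = y"
    using upper_triangular_common_fixed_vector by metis
  then have "map_matrix of_int A *v (P *v y) = P *v y" if "A \<in> {N, M}" for A
    using that by (auto simp flip: rep_fixed_vector_iff)
  moreover have "P *v y \<noteq> 0"
    using y(1) invertible_matrix_inv(2)[OF invertible_P]
    by (metis matrix_vector_mul_assoc matrix_vector_mul_lid matrix_vector_mult_0_right)
  ultimately obtain k :: "int^3" where "k \<noteq> 0" "N *v k = k" "M *v k = k"
    using integer_common_fixed_vector[of "P *v y" "{N, M}"] y by auto
  then have "(mpow N n ** mpow M m) *v k = k" for n m
    by (simp add: mpow_fixed_vector GL3Z flip: matrix_vector_mul_assoc)
  with assms \<open>k \<noteq> 0\<close> show False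
    by auto
qed

lemma word_eq_if_diag_char_eq:
  assumes "\<forall>i. diag_char i x = diag_char i y"
    and "diag_char 1 g1 \<noteq> diag_char 2 g1" and "diag_char 2 g2 \<noteq> diag_char 3 g2"
    and "diag_char 1 g3 \<noteq> diag_char 3 g3"
  shows "word x = word y"
proof -
  have "rep (word x) = rep (word y)"
  proof (rule upper_triangular_eq_if_commute)
    show "\<forall>G\<in>{rep (word g1), rep (word g2), rep (word g3)}. upper_triangular G
        \<and> G ** rep (word x) = rep (word x) ** G \<and> G ** rep (word y) = rep (word y) ** G"
      using upper_triangular_rep_word(1) by (auto simp flip: rep_mult simp: word_commute)
  qed (use assms upper_triangular_rep_word in auto)
  then show ?thesis
    by (simp add: rep_inject)
qed

lemma word_in_gen_subgroup: "word (n, m, 0) \<in> gen_subgroup {N, M}"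
  unfolding word_def by (auto intro: gen_mult mpow_in_gen_subgroup)

lemma word_C: "word (0, 0, 1) = C"
  by (simp add: word_def)

lemma C_eq_word:
  assumes "{k :: int^3. \<forall>n m. (mpow N n ** mpow M m) *v k = k} = {0}"
    and "\<forall>n m s. eig1 (mpow N n ** mpow M m ** mpow C s)"
  obtains n m where "C = word (n, m, 0)"
proof -
  define H :: "(int \<times> int \<times> int) set" where "H = {(n, m, 0) | n m. True}"
  have H: "submonoid_add H"
    unfolding H_def submonoid_add_def by (auto simp: zero_prod_def)
  have cover: "\<forall>x. diag_char 1 x = 1 \<or> diag_char 2 x = 1 \<or> diag_char 3 x = 1"
    using diag_char_cover[OF assms(2)] exhaust_3 by metis
  have nontrivial: "\<exists>x\<in>H. diag_char i x \<noteq> 1" for i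
    using diag_char_nontrivial[OF assms(1), of i] unfolding H_def by blast
  note characters = character_diag_char character_diag_char character_diag_char
  obtain h where "h \<in> H" and "diag_char 1 (0, 0, 1) = diag_char 1 h"
    and "diag_char 2 (0, 0, 1) = diag_char 2 h" and "diag_char 3 (0, 0, 1) = diag_char 3 h"
    by (rule character_kernels_cover_decomposition[OF characters H cover nontrivial nontrivial
          nontrivial])
  then have h: "\<forall>i. diag_char i (0, 0, 1) = diag_char i h"
    by (simp add: forall_3)
  obtain g1 where "g1 \<in> H" and g1: "diag_char 1 g1 \<noteq> diag_char 2 g1"
    by (rule character_kernels_cover_distinct[OF characters H _ nontrivial nontrivial])
      (use cover in blast)
  obtain g2 where "g2 \<in> H" and g2: "diag_char 2 g2 \<noteq> diag_char 3 g2"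
    by (rule character_kernels_cover_distinct[OF characters H _ nontrivial nontrivial])
      (use cover in blast)
  obtain g3 where "g3 \<in> H" and g3: "diag_char 1 g3 \<noteq> diag_char 3 g3"
    by (rule character_kernels_cover_distinct[OF characters H _ nontrivial nontrivial])
      (use cover in blast)
  have "C = word h"
    using word_eq_if_diag_char_eq[OF h g1 g2 g3] by (simp add: word_C)
  with \<open>h \<in> H\<close> show ?thesis
    using that unfolding H_def by blast
qed

end

theorem lemma2p5:
  fixes N M C :: imat3
  assumes "N \<in> GL3Z" and "M \<in> GL3Z"
    and "N ** M = M ** N"
    and "\<forall>n m. eig1 (mpow N n ** mpow M m)"
    and "{k :: int^3. \<forall>n m. (mpow N n ** mpow M m) *v k = k} = {0}"
    and "C \<in> GL3Z"
    and "C ** N = N ** C" and "C ** M = M ** C"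
    and "\<forall>n m s. eig1 (mpow N n ** mpow M m ** mpow C s)"
  shows "C \<in> gen_subgroup {N, M}"
proof -
  let ?F = "map_matrix of_int ` {N, M, C} :: (complex^3^3) set"
  have "finite ?F" and "\<forall>A\<in>?F. \<forall>B\<in>?F. A ** B = B ** A"
    using assms(3,7,8) by (auto simp flip: map_matrix_of_int_mult)
  then obtain P where "invertible P" and "\<forall>A\<in>?F. upper_triangular (matrix_inv P ** A ** P)"
    by (rule simultaneous_triangularization)
  then interpret triangularized_triple N M C P
    using assms by unfold_locales auto
  obtain n m where "C = word (n, m, 0)"
    by (rule C_eq_word[OF assms(5,9)])
  then show ?thesis
    using word_in_gen_subgroup by metis
qed

end
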